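(* Let $C_n$ be the cycle graph on $n\ge 3$ vertices and let $k\ge 2$. If $n<2k$, then $\Delta_k^t(C_n)$ is the void complex (hence shellable). If $n\ge 2k\ge 4$, then $\Delta_k^t(C_n)$ is homotopy equivalent to a single sphere of dimension $n-2k$, and hence it is not shellable.
   Context: For $k\ge 1$, the total $k$-cut complex $\Delta_k^t(G)$ is the simplicial complex on $V(G)$ whose facets are the complements $V(G)\setminus S$ of independent sets $S$ of size $k$ in $G$; it is the void complex if there are none, and otherwise it is pure of dimension $|V(G)|-k-1$. By convention the void complex is shellable. *)

theory Defs
  imports "HOL-Analysis.Analysis"
begin

text \<open>Abstract simplicial complexes are represented by their sets of faces. The void complex
  is \<^term>\<open>{}\<close> (no faces at all), as opposed to \<^term>\<open>{{}}\<close>, whose only face is the empty one.\<close>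

definition abstract_simplicial_complex :: "'a set set \<Rightarrow> bool" where
  "abstract_simplicial_complex K \<longleftrightarrow> (\<forall>\<sigma>\<in>K. finite \<sigma> \<and> (\<forall>\<tau>. \<tau> \<subseteq> \<sigma> \<longrightarrow> \<tau> \<in> K))"

definition generated_complex :: "'a set set \<Rightarrow> 'a set set" where
  "generated_complex \<F> = {\<sigma>. \<exists>F\<in>\<F>. \<sigma> \<subseteq> F}"

definition facets :: "'a set set \<Rightarrow> 'a set set" where
  "facets K = {F \<in> K. \<forall>\<sigma>\<in>K. F \<subseteq> \<sigma> \<longrightarrow> \<sigma> = F}"

text \<open>A shelling is an ordering of the facets such that each facet after the first meets the
  subcomplex generated by its predecessors in a complex that is pure of codimension one
  in it. For the void complex the empty ordering qualifies. The condition is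
  written as \<open>card G + 1 = card F\<close> to avoid truncated subtraction.\<close>

definition shelling :: "'a set set \<Rightarrow> 'a set list \<Rightarrow> bool" where
  "shelling K Fs \<longleftrightarrow> distinct Fs \<and> set Fs = facets K \<and>
     (\<forall>j. 0 < j \<and> j < length Fs \<longrightarrow>
        (\<forall>G \<in> facets (generated_complex (set (take j Fs)) \<inter> generated_complex {Fs ! j}).
           card G + 1 = card (Fs ! j)))"

definition shellable :: "'a set set \<Rightarrow> bool" where
  "shellable K \<longleftrightarrow> (\<exists>Fs. shelling K Fs)"

text \<open>Barycentric coordinates, extended by zero. The subspace topology of the product topology is the
  usual (coherent) topology of the realization for finite complexes, the only ones considered here.\<close>

definition geometric_realization :: "'a set set \<Rightarrow> ('a \<Rightarrow> real) topology" where
  "geometric_realization K = subtopology (powertop_real UNIV)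
     {x. (\<forall>v. 0 \<le> x v) \<and> {v. x v \<noteq> 0} \<in> K \<and> (\<Sum>v | x v \<noteq> 0. x v) = 1}"

text \<open>A graph is given by its vertex set \<open>V\<close> and its set \<open>E\<close> of edges, which are two-element
  subsets of \<open>V\<close>.\<close>

definition independent_set :: "'a set \<Rightarrow> 'a set set \<Rightarrow> 'a set \<Rightarrow> bool" where
  "independent_set V E S \<longleftrightarrow> S \<subseteq> V \<and> (\<forall>e\<in>E. \<not> e \<subseteq> S)"

definition total_cut_complex :: "nat \<Rightarrow> 'a set \<Rightarrow> 'a set set \<Rightarrow> 'a set set" where
  "total_cut_complex k V E = generated_complex {V - S | S. independent_set V E S \<and> card S = k}"

definition cycle_vertices :: "nat \<Rightarrow> nat set" where
  "cycle_vertices n = {0..<n}"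

definition cycle_edges :: "nat \<Rightarrow> nat set set" where
  "cycle_edges n = {{i, (i + 1) mod n} | i. i < n}"

lemma shellable_void: "shellable {}"
  by (auto simp: shellable_def shelling_def facets_def intro!: exI[of _ "[]"])

lemma abstract_simplicial_complex_total_cut_complex:
  "finite V \<Longrightarrow> abstract_simplicial_complex (total_cut_complex k V E)"
  unfolding abstract_simplicial_complex_def total_cut_complex_def generated_complex_def
  by (blast intro: finite_subset[of _ V])

lemma facets_generated_complex_antichain:
  assumes "\<And>F G. F \<in> \<F> \<Longrightarrow> G \<in> \<F> \<Longrightarrow> F \<subseteq> G \<Longrightarrow> F = G"
  shows "facets (generated_complex \<F>) = \<F>"
  using assms unfolding facets_def generated_complex_def by blast

lemma facets_total_cut_complex:
  assumes "finite V"
  shows "facets (total_cut_complex k V E) = {V - S | S. independent_set V E S \<and> card S = k}"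
  unfolding total_cut_complex_def
proof (rule facets_generated_complex_antichain)
  fix F G
  assume F: "F \<in> {V - S | S. independent_set V E S \<and> card S = k}"
    and G: "G \<in> {V - S | S. independent_set V E S \<and> card S = k}"
    and FG: "F \<subseteq> G"
  have card: "card F = card V - k" if mem: "F \<in> {V - S | S. independent_set V E S \<and> card S = k}" for F
  proof -
    obtain S where S: "F = V - S" "S \<subseteq> V" "card S = k"
      using mem by (auto simp: independent_set_def)
    then have "finite S"
      using assms finite_subset by metis
    then show ?thesis
      using S assms by (simp add: card_Diff_subset)
  qed
  have "finite G"
    using G assms by auto
  then show "F = G"
    using card_subset_eq[of G F] card[OF F] card[OF G] FG by metis
qed

end

theory Submission
  imports Defs "HOL-Library.Z2"
begin

text \<open>
  Suppose that \<open>v \<notin> R\<close> and that adding \<open>v\<close> to a face containing \<open>R\<close> gives a face again. Then the faces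
  containing \<open>R\<close> can be removed without changing the homotopy type: move the barycentric weight that is
  common to all vertices of \<open>R\<close> to \<open>v\<close>. The cut complex of the cycle is reduced by such collapses with
  \<open>R = {j..<i}\<close> and \<open>v = i + 1\<close>: if a face contains \<open>i - 1\<close> but not \<open>i\<close>, then in an independent set
  that avoids it \<open>i + 1\<close> can be exchanged for \<open>i\<close>. In this way the vertices \<open>0, \<dots>, 2k - 3\<close> are deleted
  one after the other, and what remains is the boundary of the simplex on \<open>{2k - 2..<n}\<close>, a sphere of
  dimension \<open>n - 2k\<close>.

  The complex is pure of dimension \<open>n - k - 1 > n - 2k\<close>. In a shellable complex every mod 2 cycle below
  the top dimension bounds, and a collapse preserves this property, which fails for the boundary of a
  simplex in its own dimension.
\<close>

section \<open>Collapses and geometric realizations\<close>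

text \<open>When \<open>R\<close> is a face, the condition says that its link is a cone with apex
  \<open>v\<close>, and \<open>K'\<close> is \<open>K\<close> without the open star of
  \<open>R\<close>. When \<open>R\<close> is not a face of a complex \<open>K\<close>, the collapse
  is trivial. A nonempty \<open>R\<close> lets the empty face survive and gives a minimum over
  \<open>R\<close> a meaning.\<close>

definition cone_collapse :: "'a set set \<Rightarrow> 'a set set \<Rightarrow> bool" where
  "cone_collapse K K' \<longleftrightarrow> (\<exists>R v. finite R \<and> R \<noteq> {} \<and> v \<notin> R \<and>
     (\<forall>\<sigma>\<in>K. R \<subseteq> \<sigma> \<longrightarrow> insert v \<sigma> \<in> K) \<and> K' = {\<sigma>\<in>K. \<not> R \<subseteq> \<sigma>})"

lemma cone_collapse_complex:
  "cone_collapse K K' \<Longrightarrow> abstract_simplicial_complex K \<Longrightarrow> abstract_simplicial_complex K'"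
  unfolding cone_collapse_def abstract_simplicial_complex_def by blast

lemma cone_collapse_subset: "cone_collapse K K' \<Longrightarrow> K' \<subseteq> K"
  unfolding cone_collapse_def by blast

section \<open>Coordinates and continuity in geometric realizations\<close>

lemma continuous_map_Min:
  fixes f :: "'i \<Rightarrow> 'a \<Rightarrow> real"
  assumes "finite I" "I \<noteq> {}" "\<And>i. i \<in> I \<Longrightarrow> continuous_map X euclideanreal (f i)"
  shows "continuous_map X euclideanreal (\<lambda>x. Min ((\<lambda>i. f i x) ` I))"
  using assms
proof (induction rule: finite_ne_induct)
  case (insert i I)
  have "(\<lambda>x. Min ((\<lambda>i. f i x) ` insert i I)) = (\<lambda>x. min (f i x) (Min ((\<lambda>i. f i x) ` I)))"
    using insert.hyps by (simp add: Min_insert)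
  then show ?case
    using insert by (auto intro!: continuous_map_real_min)
qed simp

text \<open>Summing over the fixed set \<open>V\<close> instead of over the support makes the
  normalization linear in the point.\<close>

lemma topspace_geometric_realization:
  assumes "finite V" "K \<subseteq> Pow V"
  shows "topspace (geometric_realization K) =
    {x. (\<forall>v. 0 \<le> x v) \<and> {v. x v \<noteq> 0} \<in> K \<and> (\<Sum>v\<in>V. x v) = 1}"
proof -
  have "(\<Sum>v | x v \<noteq> 0. x v) = (\<Sum>v\<in>V. x v)" if "{v. x v \<noteq> 0} \<in> K" for x :: "'a \<Rightarrow> real"
    using that assms by (intro sum.mono_neutral_left) auto
  then show ?thesis
    unfolding geometric_realization_def by auto
qed

lemma continuous_map_geometric_realization_iff:
  "continuous_map X (geometric_realization K) f \<longleftrightarrow>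
     (\<forall>v. continuous_map X euclideanreal (\<lambda>x. f x v)) \<and>
     f \<in> topspace X \<rightarrow> topspace (geometric_realization K)"
  unfolding geometric_realization_def continuous_map_in_subtopology
    continuous_map_componentwise_UNIV by auto

lemma continuous_map_geometric_realization_coordinate:
  "continuous_map (geometric_realization K) euclideanreal (\<lambda>x. x v)"
  unfolding geometric_realization_def
  by (intro continuous_map_from_subtopology continuous_map_product_projection) simp

text \<open>The homotopy \<open>h\<close> moves points along straight segments. At time 1 a vertex
  of \<open>R\<close> of minimal weight has weight 0, so the point lies in the realization of
  \<open>K'\<close>; on that realization \<open>\<mu>\<close> vanishes and \<open>h\<close> is
  constant. Hence \<open>h 1\<close> is a deformation retraction, with the inclusion as homotopy
  inverse.\<close>

lemma geometric_realization_cone_collapse: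
  assumes V: "finite V" "K \<subseteq> Pow V" and K: "abstract_simplicial_complex K"
    and col: "cone_collapse K K'"
  shows "geometric_realization K homotopy_equivalent_space geometric_realization K'"
proof -
  obtain R v where R: "finite R" "R \<noteq> {}" "v \<notin> R"
    and ins: "\<And>\<sigma>. \<sigma> \<in> K \<Longrightarrow> R \<subseteq> \<sigma> \<Longrightarrow> insert v \<sigma> \<in> K" and K': "K' = {\<sigma>\<in>K. \<not> R \<subseteq> \<sigma>}"
    using col unfolding cone_collapse_def by blast
  define \<mu> where "\<mu> x = Min ((\<lambda>r. x r) ` R)" for x :: "'a \<Rightarrow> real"
  \<comment> \<open>The direction of the motion: each vertex of \<open>R\<close> loses one unit and
    \<open>v\<close> gains all of them, so the total weight is preserved.\<close>
  define d where "d u = (if u = v then real (card R) else 0) - (if u \<in> R then 1 else 0)" for u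
  define h where "h t x u = x u + t * \<mu> x * d u" for t and x :: "'a \<Rightarrow> real" and u
  note top = topspace_geometric_realization[OF V]
  have K'V: "K' \<subseteq> Pow V" using V K' by auto
  note top' = topspace_geometric_realization[OF V(1) K'V]
  have \<mu>_le: "\<mu> x \<le> x r" if "r \<in> R" for x r
    using that R by (simp add: \<mu>_def)
  have \<mu>_nonneg: "0 \<le> \<mu> x" if "\<And>u. 0 \<le> x u" for x
    using that R by (auto simp: \<mu>_def)
  have \<mu>_attained: "\<exists>r\<in>R. \<mu> x = x r" for x
    unfolding \<mu>_def using Min_in[of "x ` R"] R by blast
  have h_in: "h t x \<in> topspace (geometric_realization K)"
    and h1_in: "h 1 x \<in> topspace (geometric_realization K')"
    if x: "x \<in> topspace (geometric_realization K)" and t: "0 \<le> t" "t \<le> 1" for t x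
  proof -
    have x0: "\<And>u. 0 \<le> x u" and xK: "{u. x u \<noteq> 0} \<in> K" and x1: "(\<Sum>u\<in>V. x u) = 1"
      using x by (auto simp: top)
    have main: "h s x \<in> topspace (geometric_realization K) \<and>
        (s = 1 \<longrightarrow> \<not> R \<subseteq> {u. h s x u \<noteq> 0})" if s: "0 \<le> s" "s \<le> 1" for s
    proof (cases "\<mu> x = 0")
      case True
      then obtain r where "r \<in> R" "x r = 0" using \<mu>_attained by metis
      moreover have "h s x = x" by (auto simp: h_def True)
      ultimately show ?thesis using x by auto
    next
      case False
      then have pos: "\<mu> x > 0" using \<mu>_nonneg x0 by (metis less_eq_real_def)
      then have "R \<subseteq> {u. x u \<noteq> 0}" using \<mu>_le[of _ x] by fastforce
      then have star: "insert v {u. x u \<noteq> 0} \<in> K" and "R \<subseteq> V"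
        using ins xK V by auto
      then have "v \<in> V" using V by auto
      have "{u. h s x u \<noteq> 0} \<subseteq> insert v {u. x u \<noteq> 0}"
        using \<open>R \<subseteq> {u. x u \<noteq> 0}\<close> by (auto simp: h_def d_def)
      then have "{u. h s x u \<noteq> 0} \<in> K"
        using star K unfolding abstract_simplicial_complex_def by blast
      moreover have "0 \<le> h s x u" for u
      proof (cases "u \<in> R")
        case True
        \<comment> \<open>Each vertex of \<open>R\<close> has weight at least \<open>\<mu> x\<close>
          and loses \<open>s * \<mu> x\<close>, so it stays nonnegative up to time 1.\<close>
        have "s * \<mu> x \<le> 1 * \<mu> x" using s pos by (intro mult_right_mono) auto
        then show ?thesis using True R \<mu>_le[of u x] by (auto simp: h_def d_def)
      next
        case False
        then show ?thesis using x0 s pos by (auto simp: h_def d_def)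
      qed
      moreover have "(\<Sum>u\<in>V. d u) = 0"
        unfolding d_def sum_subtractf
        using \<open>v \<in> V\<close> \<open>R \<subseteq> V\<close> V by (simp add: sum.delta sum.If_cases inf_absorb2)
      then have "(\<Sum>u\<in>V. h s x u) = 1"
        using x1 by (simp add: h_def sum.distrib flip: sum_distrib_left)
      moreover have "\<not> R \<subseteq> {u. h 1 x u \<noteq> 0}"
      proof -
        obtain r where "r \<in> R" "\<mu> x = x r" using \<mu>_attained by blast
        then have "h 1 x r = 0" using R by (auto simp: h_def d_def)
        then show ?thesis using \<open>r \<in> R\<close> by auto
      qed
      ultimately show ?thesis by (auto simp: top)
    qed
    show "h t x \<in> topspace (geometric_realization K)" using main t by blast
    show "h 1 x \<in> topspace (geometric_realization K')"
      using main[of 1] unfolding top top' by (auto simp: K')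
  qed
  have h_fix: "h t x = x" if "x \<in> topspace (geometric_realization K')" for t x
  proof -
    have "\<not> R \<subseteq> {u. x u \<noteq> 0}" "\<And>u. 0 \<le> x u" using that unfolding top' by (auto simp: K')
    then obtain r where "r \<in> R" "x r = 0" by auto
    then have "\<mu> x = 0" using \<mu>_le[of r x] \<mu>_nonneg[of x] \<open>\<And>u. 0 \<le> x u\<close> by force
    then show ?thesis by (auto simp: h_def)
  qed
  \<comment> \<open>Time and point are functions on an arbitrary space \<open>X\<close>: a product
    for the homotopy, the realization itself with constant time 1 for the retraction.\<close>
  have cont: "continuous_map X euclideanreal (\<lambda>p. h (f p) (g p) u)"
    if "continuous_map X euclideanreal f" "continuous_map X (geometric_realization K) g" for X :: "'b topology" and f g u
  proof -
    have "continuous_map X euclideanreal (\<lambda>p. g p w)" for w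
      using that(2) by (simp add: continuous_map_geometric_realization_iff)
    then show ?thesis
      unfolding h_def \<mu>_def using that(1) R
      by (intro continuous_map_add continuous_map_real_mult continuous_map_Min) auto
  qed
  let ?I = "top_of_set {0..1::real}"
  have fst: "continuous_map (prod_topology ?I (geometric_realization K)) euclideanreal fst"
    using continuous_map_fst continuous_map_into_fulltopology by blast
  have hom: "homotopic_with (\<lambda>_. True) (geometric_realization K) (geometric_realization K) id (h 1)"
    unfolding homotopic_with_def
  proof (intro exI[of _ "\<lambda>p. h (fst p) (snd p)"] conjI)
    show "continuous_map (prod_topology ?I (geometric_realization K)) (geometric_realization K)
        (\<lambda>p. h (fst p) (snd p))"
      unfolding continuous_map_geometric_realization_iff[of "prod_topology _ _"]
      using h_in cont[OF fst continuous_map_snd] by auto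
  qed (auto simp: h_def)
  have r: "continuous_map (geometric_realization K) (geometric_realization K') (h 1)"
    unfolding continuous_map_geometric_realization_iff[of _ K']
    using h1_in[of _ 1] cont[of "geometric_realization K" "\<lambda>_. 1" id] by auto
  have "topspace (geometric_realization K') \<subseteq> topspace (geometric_realization K)"
    unfolding top top' by (auto simp: K')
  then have i: "continuous_map (geometric_realization K') (geometric_realization K) id"
    unfolding continuous_map_geometric_realization_iff[of _ K]
    using continuous_map_geometric_realization_coordinate by auto
  have "homotopic_with (\<lambda>_. True) (geometric_realization K) (geometric_realization K) (id \<circ> h 1) id"
    using hom by (simp add: homotopic_with_symD)
  moreover have "homotopic_with (\<lambda>_. True) (geometric_realization K') (geometric_realization K')
      (h 1 \<circ> id) id"
    using continuous_map_compose[OF i r] h_fix by (intro homotopic_with_equal) auto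
  ultimately show ?thesis
    unfolding homotopy_equivalent_space_def using r i by blast
qed

text \<open>Both sides represent the rays from the origin in the quotient of the space of all
  vectors on \<open>m + 2\<close> vertices by the constant vectors. The sphere picks from a class
  the vector with last coordinate 0 and from a ray the one of Euclidean norm 1; the simplex boundary
  picks the vector with minimum 0 and the one with coordinate sum 1. \<open>f\<close> and
  \<open>g\<close> change one normalization into the other.\<close>

lemma geometric_realization_simplex_boundary:
  "geometric_realization {\<sigma>. \<sigma> \<subset> {a..a + Suc m}} homeomorphic_space nsphere m"
proof -
  let ?V = "{a..a + Suc m}" and ?X = "geometric_realization {\<sigma>. \<sigma> \<subset> {a..a + Suc m}}"
  define N where "N y = sqrt (\<Sum>i\<le>m. (y i)\<^sup>2)" for y :: "nat \<Rightarrow> real"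
  define D where "D x i = (if i \<le> m then x (a + i) - x (a + Suc m) else 0)" for x :: "nat \<Rightarrow> real" and i
  define f where "f x i = D x i / N (D x)" for x i
  \<comment> \<open>The index \<open>Suc m\<close> is included: it stands for the last vertex, where
    points of the sphere have coordinate 0.\<close>
  define M where "M u = Min ((\<lambda>i. u i) ` {..Suc m})" for u :: "nat \<Rightarrow> real"
  define s where "s u = (\<Sum>i\<le>Suc m. u i - M u)" for u
  define g where "g u j = (if j \<in> ?V then (u (j - a) - M u) / s u else 0)" for u j
  have top: "topspace ?X = {x. (\<forall>v. 0 \<le> x v) \<and> {v. x v \<noteq> 0} \<subset> ?V \<and> (\<Sum>v\<in>?V. x v) = 1}"
    by (subst topspace_geometric_realization[of ?V]) auto
  have topS: "topspace (nsphere m) = {u. (\<Sum>i\<le>m. (u i)\<^sup>2) = 1 \<and> (\<forall>i>m. u i = 0)}"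
    by (auto simp: nsphere)
  have sum_shift: "(\<Sum>v\<in>?V. x v) = (\<Sum>i\<le>Suc m. x (a + i))" for x :: "nat \<Rightarrow> real"
    using sum.shift_bounds_cl_nat_ivl[of x 0 a "Suc m"] by (simp add: add.commute atMost_atLeast0)
  have M_le: "M u \<le> u i" if "i \<le> Suc m" for u i
    using that by (simp add: M_def)
  have M_attained: "\<exists>i\<le>Suc m. M u = u i" for u
    unfolding M_def using Min_in[of "u ` {..Suc m}"] by blast
  have N_pos: "N y > 0" if "i \<le> m" "y i \<noteq> 0" for y i
  proof -
    have "(\<Sum>i\<le>m. (y i)\<^sup>2) > 0"
      using that by (intro sum_pos2[of _ i]) auto
    then show ?thesis by (simp add: N_def)
  qed
  have vanishing: "\<exists>j. a \<le> j \<and> j \<le> a + Suc m \<and> x j = 0" if "x \<in> topspace ?X" for x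
    using that unfolding top by auto
  have ND: "N (D x) > 0" if x: "x \<in> topspace ?X" for x
  proof -
    obtain j where j: "a \<le> j" "j \<le> a + Suc m" "x j = 0"
      using vanishing[OF x] by blast
    have "\<exists>i\<le>m. D x i \<noteq> 0"
    proof (rule ccontr)
      \<comment> \<open>All coordinates would agree with one that vanishes, against the total weight
        1.\<close>
      assume "\<not> ?thesis"
      then have eq: "x (a + i) = x (a + Suc m)" if "i \<le> Suc m" for i
        using that by (cases "i = Suc m") (auto simp: D_def)
      from eq[of "j - a"] have "x (a + i) = 0" if "i \<le> Suc m" for i
        using eq[OF that] j by simp
      then have "(\<Sum>v\<in>?V. x v) = 0" unfolding sum_shift by simp
      moreover have "(\<Sum>v\<in>?V. x v) = 1" using x unfolding top by blast
      ultimately show False by simp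
    qed
    then show ?thesis using N_pos by blast
  qed
  have s_pos: "s u > 0" if u: "u \<in> topspace (nsphere m)" for u
  proof (rule ccontr)
    assume "\<not> s u > 0"
    moreover have nonneg: "\<And>i. i \<in> {..Suc m} \<Longrightarrow> 0 \<le> u i - M u" using M_le by auto
    ultimately have "s u = 0"
      using sum_nonneg[of "{..Suc m}" "\<lambda>i. u i - M u"] unfolding s_def by force
    then have eq: "\<forall>i\<in>{..Suc m}. u i - M u = 0"
      unfolding s_def using sum_nonneg_eq_0_iff[of "{..Suc m}" "\<lambda>i. u i - M u"] nonneg by blast
    \<comment> \<open>All coordinates up to \<open>Suc m\<close> equal the minimum and the last one
      is 0, so \<open>u\<close> would be the origin.\<close>
    then have "u (Suc m) = M u" by auto
    then have "M u = 0" using u by (simp add: topS)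
    then have "(\<Sum>i\<le>m. (u i)\<^sup>2) = 0" using eq by simp
    then show False using u by (simp add: topS)
  qed
  have f_in: "f x \<in> topspace (nsphere m)" if "x \<in> topspace ?X" for x
  proof -
    have "(\<Sum>i\<le>m. (f x i)\<^sup>2) = (\<Sum>i\<le>m. (D x i)\<^sup>2) / (N (D x))\<^sup>2"
      by (simp add: f_def power_divide sum_divide_distrib)
    also have "\<dots> = 1"
      using ND[OF that] by (simp add: N_def sum_nonneg)
    finally show ?thesis by (simp add: topS f_def D_def)
  qed
  have g_in: "g u \<in> topspace ?X" if u: "u \<in> topspace (nsphere m)" for u
  proof -
    have nonneg: "0 \<le> g u j" for j
      using M_le[of "j - a" u] s_pos[OF u] by (auto simp: g_def)
    obtain i where i: "i \<le> Suc m" "M u = u i" using M_attained by blast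
    then have "a + i \<in> ?V" "g u (a + i) = 0" by (auto simp: g_def)
    moreover have "{v. g u v \<noteq> 0} \<subseteq> ?V" unfolding g_def by auto
    ultimately have "{v. g u v \<noteq> 0} \<subset> ?V" by blast
    moreover have "(\<Sum>v\<in>?V. g u v) = (\<Sum>i\<le>Suc m. (u i - M u) / s u)"
      unfolding sum_shift by (rule sum.cong) (auto simp: g_def)
    then have "(\<Sum>v\<in>?V. g u v) = s u / s u"
      by (simp only: s_def sum_divide_distrib)
    then have "(\<Sum>v\<in>?V. g u v) = 1" using s_pos[OF u] by simp
    ultimately show ?thesis using nonneg unfolding top by blast
  qed
  have gf: "g (f x) = x" if x: "x \<in> topspace ?X" for x
  proof -
    define c where "c = N (D x)"
    have c: "c > 0" using ND[OF x] by (simp add: c_def)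
    have fi: "f x i = (x (a + i) - x (a + Suc m)) / c" if "i \<le> Suc m" for i
      using that by (cases "i = Suc m") (auto simp: f_def D_def c_def)
    obtain j where j: "a \<le> j" "j \<le> a + Suc m" "x j = 0"
      using vanishing[OF x] by blast
    have x0: "\<And>v. 0 \<le> x v" using x unfolding top by auto
    \<comment> \<open>The minimum is attained at a vertex where \<open>x\<close> vanishes, so
      subtracting it undoes the shift by the last coordinate.\<close>
    have "M (f x) = - x (a + Suc m) / c"
    proof (rule antisym)
      show "M (f x) \<le> - x (a + Suc m) / c"
        using M_le[of "j - a" "f x"] fi[of "j - a"] j by simp
      obtain i where "i \<le> Suc m" "M (f x) = f x i" using M_attained by blast
      then show "- x (a + Suc m) / c \<le> M (f x)"
        using fi[of i] x0[of "a + i"] c by (simp add: diff_divide_distrib)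
    qed
    then have diff: "f x i - M (f x) = x (a + i) / c" if "i \<le> Suc m" for i
      using fi[OF that] by (simp add: diff_divide_distrib)
    have "s (f x) = (\<Sum>i\<le>Suc m. x (a + i) / c)"
      unfolding s_def by (rule sum.cong) (use diff in auto)
    also have "\<dots> = (\<Sum>v\<in>?V. x v) / c"
      unfolding sum_shift by (simp only: sum_divide_distrib)
    also have "(\<Sum>v\<in>?V. x v) = 1" using x unfolding top by blast
    finally have s: "s (f x) = 1 / c" .
    have outside: "x j = 0" if "j \<notin> ?V" for j using x that unfolding top by blast
    show ?thesis
    proof
      fix j
      show "g (f x) j = x j"
      proof (cases "j \<in> ?V")
        case True
        then have "f x (j - a) - M (f x) = x j / c" using diff[of "j - a"] by auto
        then show ?thesis using True c by (simp add: g_def s)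
      next
        case False
        then show ?thesis using outside[OF False] by (simp only: g_def if_False)
      qed
    qed
  qed
  have fg: "f (g u) = u" if u: "u \<in> topspace (nsphere m)" for u
  proof -
    have sp: "s u > 0" using s_pos[OF u] .
    have u0: "u i = 0" if "i > m" for i using u that by (simp add: topS)
    \<comment> \<open>Taking the difference with the last vertex cancels \<open>M u\<close>, because
      \<open>u (Suc m)\<close> is 0.\<close>
    have D: "D (g u) i = u i / s u" for i
      using u0 by (auto simp: D_def g_def diff_divide_distrib)
    have "(\<Sum>i\<le>m. (D (g u) i)\<^sup>2) = (\<Sum>i\<le>m. (u i)\<^sup>2) / (s u)\<^sup>2"
      unfolding D by (simp add: power_divide sum_divide_distrib)
    also have "\<dots> = (1 / s u)\<^sup>2" using u by (simp add: topS power_divide)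
    finally have "N (D (g u)) = 1 / s u" using sp by (simp add: N_def)
    then show ?thesis using sp by (auto simp: f_def D)
  qed
  have fc: "continuous_map ?X (nsphere m) f"
  proof -
    have D: "continuous_map ?X euclideanreal (\<lambda>x. D x i)" for i
      unfolding D_def
      by (cases "i \<le> m") (auto intro!: continuous_map_diff continuous_map_geometric_realization_coordinate)
    have "continuous_map ?X euclideanreal (\<lambda>x. N (D x))"
      unfolding N_def by (intro continuous_map_sqrt continuous_map_sum continuous_map_real_pow D) auto
    then have "continuous_map ?X euclideanreal (\<lambda>x. f x i)" for i
      unfolding f_def using ND D by (intro continuous_map_real_divide) fastforce+
    moreover have "f ` topspace ?X \<subseteq> {u. (\<Sum>i\<le>m. (u i)\<^sup>2) = 1 \<and> (\<forall>i>m. u i = 0)}"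
      using f_in topS by blast
    ultimately show ?thesis
      unfolding nsphere continuous_map_in_subtopology continuous_map_componentwise_UNIV by blast
  qed
  have gc: "continuous_map (nsphere m) ?X g"
  proof -
    note pr = continuous_map_nsphere_projection
    have M: "continuous_map (nsphere m) euclideanreal M"
      unfolding M_def by (intro continuous_map_Min pr) auto
    have "continuous_map (nsphere m) euclideanreal s"
      unfolding s_def by (intro continuous_map_sum continuous_map_diff pr M) auto
    then have "continuous_map (nsphere m) euclideanreal (\<lambda>u. g u j)" for j
      unfolding g_def using s_pos
      by (cases "j \<in> ?V") (auto intro!: continuous_map_real_divide continuous_map_diff pr M, fastforce)
    then show ?thesis
      unfolding continuous_map_geometric_realization_iff using g_in by blast
  qed
  show ?thesis
    unfolding homeomorphic_space_def homeomorphic_maps_def using fc gc gf fg by blast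
qed

section \<open>Chains modulo two\<close>

text \<open>Chains are graded by the cardinality of the faces, which is the dimension plus one, and the empty
  face counts, so that \<open>acyclic_at V K c\<close> is the vanishing of the reduced homology in dimension \<open>c - 1\<close>.\<close>

definition boundary :: "'a set \<Rightarrow> ('a set \<Rightarrow> bit) \<Rightarrow> 'a set \<Rightarrow> bit" where
  "boundary V z \<rho> = (\<Sum>v\<in>V - \<rho>. z (insert v \<rho>))"

text \<open>Chains are functions on all sets, and \<open>boundary\<close> depends on the ambient
  vertex set only, so a chain of a subcomplex is literally a chain of the complex with the same
  boundary.\<close>

definition chain :: "'a set set \<Rightarrow> nat \<Rightarrow> ('a set \<Rightarrow> bit) \<Rightarrow> bool" where
  "chain K c z \<longleftrightarrow> (\<forall>\<sigma>. z \<sigma> \<noteq> 0 \<longrightarrow> \<sigma> \<in> K \<and> card \<sigma> = c)"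

definition acyclic_at :: "'a set \<Rightarrow> 'a set set \<Rightarrow> nat \<Rightarrow> bool" where
  "acyclic_at V K c \<longleftrightarrow> (\<forall>z. chain K c z \<and> boundary V z = (\<lambda>_. 0) \<longrightarrow>
     (\<exists>w. chain K (c + 1) w \<and> boundary V w = z))"

text \<open>Sums of bits are to stay ring sums instead of being rewritten to exclusive or.\<close>

declare add_bit_eq_xor [simp del]

lemma bit_add_self: "(a::bit) + a = 0"
  by (simp flip: mult_2)

lemma bit_add_self_right: "(a::bit) + (a + b) = b"
  by (metis add.assoc add_0 bit_add_self)

lemma chainD: "chain K c z \<Longrightarrow> \<sigma> \<notin> K \<or> card \<sigma> \<noteq> c \<Longrightarrow> z \<sigma> = 0"
  by (auto simp: chain_def)

lemma boundary_add: "boundary V (\<lambda>\<sigma>. w \<sigma> + z \<sigma>) = (\<lambda>\<sigma>. boundary V w \<sigma> + boundary V z \<sigma>)"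
  by (auto simp: boundary_def sum.distrib)

text \<open>Every unordered pair is counted twice. Applied to the insertion of two vertices in
  either order, this gives that the boundary squares to zero.\<close>

lemma sum_distinct_pairs_bit:
  fixes g :: "'a \<Rightarrow> 'a \<Rightarrow> bit"
  assumes "finite A" and sym: "\<And>u v. g u v = g v u"
  shows "(\<Sum>v\<in>A. \<Sum>u\<in>A - {v}. g u v) = 0"
  using assms(1)
proof induction
  case (insert a A)
  have "(\<Sum>v\<in>insert a A. \<Sum>u\<in>insert a A - {v}. g u v)
      = (\<Sum>u\<in>A. g u a) + (\<Sum>v\<in>A. \<Sum>u\<in>insert a A - {v}. g u v)"
    using insert by simp
  also have "(\<Sum>v\<in>A. \<Sum>u\<in>insert a A - {v}. g u v) = (\<Sum>v\<in>A. g a v + (\<Sum>u\<in>A - {v}. g u v))"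
  proof (rule sum.cong)
    fix v assume "v \<in> A"
    then have "insert a A - {v} = insert a (A - {v})"
      using insert.hyps by auto
    then show "(\<Sum>u\<in>insert a A - {v}. g u v) = g a v + (\<Sum>u\<in>A - {v}. g u v)"
      using insert.hyps by simp
  qed simp
  also have "\<dots> = (\<Sum>u\<in>A. g u a)"
    unfolding sum.distrib insert.IH by (simp add: sym[of a])
  finally show ?case
    by (simp add: bit_add_self)
qed simp

lemma boundary_boundary:
  assumes "finite V"
  shows "boundary V (boundary V z) = (\<lambda>_. 0)"
proof
  fix \<rho>
  have "boundary V (boundary V z) \<rho>
      = (\<Sum>v\<in>V - \<rho>. \<Sum>u\<in>(V - \<rho>) - {v}. z (insert u (insert v \<rho>)))"
    unfolding boundary_def by (rule sum.cong[OF refl], rule sum.cong) auto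
  also have "\<dots> = 0"
    using assms by (intro sum_distinct_pairs_bit) (auto simp: insert_commute)
  finally show "boundary V (boundary V z) \<rho> = 0" .
qed

section \<open>Invariance of acyclicity under collapses\<close>

lemma chain_boundary:
  assumes "abstract_simplicial_complex K" and "chain K (Suc c) y"
  shows "chain K c (boundary V y)"
  unfolding chain_def
proof (intro allI impI)
  fix \<sigma> assume "boundary V y \<sigma> \<noteq> 0"
  then obtain v where v: "v \<in> V - \<sigma>" "y (insert v \<sigma>) \<noteq> 0"
    unfolding boundary_def by (metis (no_types, lifting) sum.neutral)
  then have "insert v \<sigma> \<in> K" "card (insert v \<sigma>) = Suc c"
    using assms(2) by (auto simp: chain_def)
  moreover from this have "finite \<sigma>" "\<sigma> \<in> K"
    using assms(1) unfolding abstract_simplicial_complex_def by auto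
  ultimately show "\<sigma> \<in> K \<and> card \<sigma> = c"
    using v by auto
qed

lemma chain_add: "chain K c w \<Longrightarrow> chain K c z \<Longrightarrow> chain K c (\<lambda>\<sigma>. w \<sigma> + z \<sigma>)"
  unfolding chain_def by (metis add_0)

text \<open>The faces containing \<open>R\<close> are matched by inserting \<open>v\<close>, so the
  relative chains carry no homology and \<open>w\<close> can be moved off these faces by a boundary.
  \<open>R\<close> may be empty, as for the first facet of a shelling; then \<open>w\<close> itself
  equals \<open>boundary V y\<close>.\<close>

lemma push_chain_off_cone:
  assumes V: "finite V" "K \<subseteq> Pow V" and K: "abstract_simplicial_complex K"
    and v: "v \<notin> R" "\<And>\<sigma>. \<sigma> \<in> K \<Longrightarrow> R \<subseteq> \<sigma> \<Longrightarrow> insert v \<sigma> \<in> K"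
    and w: "chain K c w" "\<And>\<sigma>. \<sigma> \<in> K \<Longrightarrow> R \<subseteq> \<sigma> \<Longrightarrow> boundary V w \<sigma> = 0"
  obtains y where "chain K (Suc c) y" "chain {\<sigma>\<in>K. \<not> R \<subseteq> \<sigma>} c (\<lambda>\<sigma>. w \<sigma> + boundary V y \<sigma>)"
proof
  \<comment> \<open>The cone with apex \<open>v\<close> over the part of \<open>w\<close> on faces
    that contain \<open>R\<close> but not \<open>v\<close>; its boundary cancels exactly that
    part.\<close>
  define y where "y \<sigma> = (if v \<in> \<sigma> \<and> \<sigma> \<in> K \<and> R \<subseteq> \<sigma> then w (\<sigma> - {v}) else 0)" for \<sigma>
  define w' where "w' \<sigma> = w \<sigma> + boundary V y \<sigma>" for \<sigma>
  have fin: "finite \<sigma>" if "\<sigma> \<in> K" for \<sigma>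
    using that K by (auto simp: abstract_simplicial_complex_def)
  have down: "\<tau> \<in> K" if "\<sigma> \<in> K" "\<tau> \<subseteq> \<sigma>" for \<sigma> \<tau>
    using that K by (auto simp: abstract_simplicial_complex_def)
  show y: "chain K (Suc c) y"
    unfolding chain_def
  proof (intro allI impI conjI)
    fix \<sigma> assume "y \<sigma> \<noteq> 0"
    then have \<sigma>: "v \<in> \<sigma>" "\<sigma> \<in> K" "w (\<sigma> - {v}) \<noteq> 0"
      by (auto simp: y_def split: if_splits)
    then show "\<sigma> \<in> K" by simp
    have "card (\<sigma> - {v}) = c"
      using \<sigma> w(1) by (auto simp: chain_def)
    then show "card \<sigma> = Suc c"
      using \<sigma> fin[of \<sigma>] by (metis card_Suc_Diff1)
  qed
  have w'K: "chain K c w'"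
    unfolding w'_def using chain_add[OF w(1) chain_boundary[OF K y]] .
  have bw': "boundary V w' = boundary V w"
    unfolding w'_def boundary_add boundary_boundary[OF V(1)] by simp
  have off: "w' \<sigma> = 0" if \<sigma>: "\<sigma> \<in> K" "R \<subseteq> \<sigma>" "v \<notin> \<sigma>" for \<sigma>
  proof -
    have ins: "insert v \<sigma> \<in> K" using v(2) \<sigma> by blast
    then have "v \<in> V" using V(2) by auto
    have "boundary V y \<sigma> = (\<Sum>u\<in>{v}. y (insert u \<sigma>))"
      unfolding boundary_def
      by (rule sum.mono_neutral_right) (use V \<open>v \<in> V\<close> \<sigma> in \<open>auto simp: y_def\<close>)
    also have "\<dots> = w \<sigma>"
      using \<sigma> ins by (auto simp: y_def)
    finally show ?thesis
      by (simp add: w'_def bit_add_self)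
  qed
  have "w' \<sigma> = 0" if \<sigma>: "\<sigma> \<in> K" "R \<subseteq> \<sigma>" for \<sigma>
  proof (cases "v \<in> \<sigma>")
    case True
    define \<rho> where "\<rho> = \<sigma> - {v}"
    have \<rho>: "\<rho> \<in> K" "R \<subseteq> \<rho>" "v \<notin> \<rho>" "insert v \<rho> = \<sigma>"
      using \<sigma> v(1) True down[of \<sigma> \<rho>] by (auto simp: \<rho>_def)
    have "v \<in> V" using True \<sigma> V by auto
    \<comment> \<open>At \<open>\<rho>\<close> every term except the one for \<open>v\<close>
      belongs to a face without \<open>v\<close>, which was cancelled already, or to a non-face; so
      the remaining term vanishes too.\<close>
    have "0 = boundary V w' \<rho>"
      using bw' w(2)[OF \<rho>(1,2)] by simp
    also have "\<dots> = (\<Sum>u\<in>{v}. w' (insert u \<rho>))"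
      unfolding boundary_def
    proof (rule sum.mono_neutral_right)
      show "\<forall>u\<in>V - \<rho> - {v}. w' (insert u \<rho>) = 0"
      proof
        fix u assume u: "u \<in> V - \<rho> - {v}"
        show "w' (insert u \<rho>) = 0"
        proof (cases "insert u \<rho> \<in> K")
          case True
          then show ?thesis using off[of "insert u \<rho>"] u \<rho> by auto
        next
          case False
          then show ?thesis using chainD[OF w'K] by blast
        qed
      qed
    qed (use V \<open>v \<in> V\<close> \<rho> in auto)
    finally show ?thesis using \<rho> by simp
  qed (use off \<sigma> in blast)
  then have "chain {\<sigma>\<in>K. \<not> R \<subseteq> \<sigma>} c w'"
    using w'K unfolding chain_def by blast
  then show "chain {\<sigma>\<in>K. \<not> R \<subseteq> \<sigma>} c (\<lambda>\<sigma>. w \<sigma> + boundary V y \<sigma>)"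
    by (simp add: w'_def[abs_def])
qed

text \<open>A filling of \<open>z\<close> in \<open>K\<close> has zero boundary on the removed
  faces, because \<open>z\<close> lives on \<open>K'\<close>. Pushing it off these faces adds a
  boundary, so it still fills \<open>z\<close>.\<close>

lemma acyclic_at_cone_collapse:
  assumes "finite V" "K \<subseteq> Pow V" "abstract_simplicial_complex K"
    and "cone_collapse K K'" and "acyclic_at V K c"
  shows "acyclic_at V K' c"
  unfolding acyclic_at_def
proof (intro allI impI, elim conjE)
  fix z assume z: "chain K' c z" "boundary V z = (\<lambda>_. 0)"
  obtain R v where R: "v \<notin> R" "\<And>\<sigma>. \<sigma> \<in> K \<Longrightarrow> R \<subseteq> \<sigma> \<Longrightarrow> insert v \<sigma> \<in> K"
    and K': "K' = {\<sigma>\<in>K. \<not> R \<subseteq> \<sigma>}"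
    using assms(4) unfolding cone_collapse_def by blast
  have "chain K c z"
    using z(1) unfolding K' chain_def by blast
  then obtain w where w: "chain K (Suc c) w" "boundary V w = z"
    using assms(5) z(2) unfolding acyclic_at_def by fastforce
  have "boundary V w \<sigma> = 0" if "\<sigma> \<in> K" "R \<subseteq> \<sigma>" for \<sigma>
    unfolding w(2) using that chainD[OF z(1)] K' by blast
  from push_chain_off_cone[OF assms(1-3) R w(1) this]
  obtain y where y: "chain K' (Suc c) (\<lambda>\<sigma>. w \<sigma> + boundary V y \<sigma>)"
    unfolding K' by blast
  have "boundary V (\<lambda>\<sigma>. w \<sigma> + boundary V y \<sigma>) = z"
    unfolding boundary_add boundary_boundary[OF assms(1)] w(2) by simp
  then show "\<exists>w. chain K' (c + 1) w \<and> boundary V w = z"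
    using y by auto
qed

text \<open>The boundary of \<open>\<tau>\<close> is a nonzero cycle, and no proper subset of
  \<open>\<tau>\<close> is large enough to carry a filling.\<close>

lemma not_acyclic_at_simplex_boundary:
  assumes "finite V" "\<tau> \<subseteq> V" "card \<tau> = Suc c"
  shows "\<not> acyclic_at V {\<sigma>. \<sigma> \<subset> \<tau>} c"
proof
  assume ac: "acyclic_at V {\<sigma>. \<sigma> \<subset> \<tau>} c"
  define y where "y \<sigma> = (if \<sigma> = \<tau> then 1 else 0 :: bit)" for \<sigma>
  define z where "z = boundary V y"
  have fin: "finite \<tau>" using assms finite_subset by blast
  have "chain {\<sigma>. \<sigma> \<subset> \<tau>} c z"
    unfolding chain_def
  proof (intro allI impI)
    fix \<sigma> assume "z \<sigma> \<noteq> 0"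
    then obtain v where v: "v \<in> V - \<sigma>" "y (insert v \<sigma>) \<noteq> 0"
      unfolding z_def boundary_def by (metis (no_types, lifting) sum.neutral)
    then have "insert v \<sigma> = \<tau>"
      by (auto simp: y_def split: if_splits)
    then show "\<sigma> \<in> {\<sigma>. \<sigma> \<subset> \<tau>} \<and> card \<sigma> = c"
      using v assms(3) fin by auto
  qed
  moreover have "boundary V z = (\<lambda>_. 0)"
    unfolding z_def by (rule boundary_boundary[OF assms(1)])
  ultimately obtain w where w: "chain {\<sigma>. \<sigma> \<subset> \<tau>} (Suc c) w" "boundary V w = z"
    using ac unfolding acyclic_at_def by fastforce
  have "w \<sigma> = 0" for \<sigma>
    using w(1) psubset_card_mono[OF fin, of \<sigma>] assms(3) unfolding chain_def by fastforce
  then have "z = (\<lambda>_. 0)"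
    using w(2) by (auto simp: boundary_def[abs_def])
  moreover obtain x where "x \<in> \<tau>"
    using assms(3) by fastforce
  moreover from this have "z (\<tau> - {x}) = (\<Sum>u\<in>{x}. y (insert u (\<tau> - {x})))"
    unfolding z_def boundary_def
    by (intro sum.mono_neutral_right) (use assms in \<open>auto simp: y_def\<close>)
  ultimately show False
    by (auto simp: y_def insert_absorb)
qed

section \<open>Acyclicity of shellable complexes below the top dimension\<close>

lemma face_subset_facet:
  assumes "finite F" "K \<subseteq> Pow F" "\<sigma> \<in> K"
  obtains G where "G \<in> facets K" "\<sigma> \<subseteq> G"
proof -
  have "finite K" using assms(1,2) by (simp add: finite_subset)
  then obtain G where "G \<in> K" "\<sigma> \<subseteq> G" "\<forall>\<tau>\<in>K. G \<subseteq> \<tau> \<longrightarrow> \<tau> = G"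
    using finite_has_maximal2[of K \<sigma>] assms(3) by metis
  then show ?thesis using that by (auto simp: facets_def)
qed

lemma complex_generated_complex:
  "(\<And>F. F \<in> \<F> \<Longrightarrow> finite F) \<Longrightarrow> abstract_simplicial_complex (generated_complex \<F>)"
  unfolding abstract_simplicial_complex_def generated_complex_def
  by (blast intro: finite_subset)

text \<open>\<open>R\<close> is the restriction of the new facet: the faces that \<open>F\<close>
  adds are the subsets of \<open>F\<close> containing \<open>R\<close>. If \<open>R = F\<close>,
  only \<open>F\<close> is added, which is too large to matter for \<open>c\<close>-chains.
  Otherwise any \<open>v\<close> in \<open>F - R\<close> is an apex, and the cycle can be pushed
  into the old complex.\<close>

lemma acyclic_at_add_facet:
  assumes V: "finite V" "\<And>G. G \<in> insert F \<F> \<Longrightarrow> G \<subseteq> V"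
    and pure: "\<And>G. G \<in> facets (generated_complex \<F> \<inter> generated_complex {F}) \<Longrightarrow> card G + 1 = card F"
    and c: "c < card F" and ac: "acyclic_at V (generated_complex \<F>) c"
  shows "acyclic_at V (generated_complex (insert F \<F>)) c"
  unfolding acyclic_at_def
proof (intro allI impI, elim conjE)
  let ?L = "generated_complex \<F>" and ?K = "generated_complex (insert F \<F>)"
  fix z assume z: "chain ?K c z" "boundary V z = (\<lambda>_. 0)"
  define R where "R = {r\<in>F. F - {r} \<in> ?L}"
  have fin: "finite F" using V finite_subset by blast
  have K: "abstract_simplicial_complex ?K"
    using V by (intro complex_generated_complex) (blast intro: finite_subset)
  have KV: "?K \<subseteq> Pow V"
    using V(2) by (fastforce simp: generated_complex_def)
  have new_iff: "\<sigma> \<in> ?L \<longleftrightarrow> \<not> R \<subseteq> \<sigma>" if "\<sigma> \<subseteq> F" for \<sigma>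
  proof
    assume "\<sigma> \<in> ?L"
    then have "\<sigma> \<in> ?L \<inter> generated_complex {F}"
      using that by (auto simp: generated_complex_def)
    then obtain G where G: "G \<in> facets (?L \<inter> generated_complex {F})" "\<sigma> \<subseteq> G"
      using face_subset_facet[OF fin, of "?L \<inter> generated_complex {F}" \<sigma>]
      by (auto simp: generated_complex_def)
    then have GF: "G \<subseteq> F" "G \<in> ?L"
      by (auto simp: facets_def generated_complex_def)
    then have "card (F - G) = 1"
      \<comment> \<open>Purity enters here: the old part of \<open>F\<close> is covered by sets
        \<open>F - {r}\<close>.\<close>
      using pure[OF G(1)] fin by (simp add: card_Diff_subset finite_subset)
    then obtain r where r: "F - G = {r}"
      using card_1_singletonE by blast
    then have "G = F - {r}" using GF by auto
    then have "r \<in> R" using r GF by (auto simp: R_def)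
    then show "\<not> R \<subseteq> \<sigma>" using r G by auto
  next
    assume "\<not> R \<subseteq> \<sigma>"
    then obtain r where "r \<in> R" "r \<notin> \<sigma>" by auto
    then have "\<sigma> \<subseteq> F - {r}" "F - {r} \<in> ?L" using that by (auto simp: R_def)
    then show "\<sigma> \<in> ?L" by (auto simp: generated_complex_def)
  qed
  show "\<exists>w. chain ?K (c + 1) w \<and> boundary V w = z"
  proof (cases "R = F")
    case True
    have "\<sigma> \<in> ?L" if "z \<sigma> \<noteq> 0" for \<sigma>
    proof (rule ccontr)
      assume "\<sigma> \<notin> ?L"
      moreover have "\<sigma> \<in> ?K" "card \<sigma> = c" using z(1) that by (auto simp: chain_def)
      ultimately have "\<sigma> \<subseteq> F" by (auto simp: generated_complex_def)
      then have "\<sigma> = F" using new_iff[of \<sigma>] \<open>\<sigma> \<notin> ?L\<close> True by auto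
      then show False using c \<open>card \<sigma> = c\<close> by simp
    qed
    then have "chain ?L c z" using z(1) by (auto simp: chain_def)
    then obtain w where "chain ?L (c + 1) w" "boundary V w = z"
      using ac z(2) unfolding acyclic_at_def by blast
    then show ?thesis by (auto simp: chain_def generated_complex_def)
  next
    case False
    then obtain v where v: "v \<in> F" "v \<notin> R" by (auto simp: R_def)
    have old: "\<sigma> \<in> ?L" if "\<sigma> \<in> ?K" "\<not> R \<subseteq> \<sigma>" for \<sigma>
      using that new_iff[of \<sigma>] by (auto simp: generated_complex_def)
    have new: "\<sigma> \<subseteq> F" if \<sigma>: "\<sigma> \<in> ?K" "R \<subseteq> \<sigma>" for \<sigma>
    proof (rule ccontr)
      assume "\<not> \<sigma> \<subseteq> F"
      then have "\<sigma> \<in> ?L" using \<sigma> by (auto simp: generated_complex_def)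
      \<comment> \<open>Cutting down to \<open>F\<close> gives an old subset of \<open>F\<close>
        that still contains \<open>R\<close>.\<close>
      then have "\<sigma> \<inter> F \<in> ?L" by (auto simp: generated_complex_def)
      then show False using new_iff[of "\<sigma> \<inter> F"] \<sigma> by (auto simp: R_def)
    qed
    have "insert v \<sigma> \<in> ?K" if "\<sigma> \<in> ?K" "R \<subseteq> \<sigma>" for \<sigma>
      using new[OF that] v by (auto simp: generated_complex_def)
    from push_chain_off_cone[OF V(1) KV K v(2) this z(1)]
    obtain y where y: "chain ?K (Suc c) y"
      and z': "chain {\<sigma>\<in>?K. \<not> R \<subseteq> \<sigma>} c (\<lambda>\<sigma>. z \<sigma> + boundary V y \<sigma>)"
      using z(2) by auto
    have "chain ?L c (\<lambda>\<sigma>. z \<sigma> + boundary V y \<sigma>)"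
      using z' old unfolding chain_def by blast
    moreover have "boundary V (\<lambda>\<sigma>. z \<sigma> + boundary V y \<sigma>) = (\<lambda>_. 0)"
      unfolding boundary_add boundary_boundary[OF V(1)] z(2) by simp
    ultimately obtain w where w: "chain ?L (c + 1) w"
      "boundary V w = (\<lambda>\<sigma>. z \<sigma> + boundary V y \<sigma>)"
      using ac unfolding acyclic_at_def by blast
    have "chain ?K (Suc c) w"
      using w(1) by (auto simp: chain_def generated_complex_def)
    then have "chain ?K (c + 1) (\<lambda>\<sigma>. y \<sigma> + w \<sigma>)"
      using chain_add[OF y] by simp
    \<comment> \<open>The pushed cycle is \<open>z\<close> plus the boundary of \<open>y\<close>;
      modulo two the latter cancels.\<close>
    moreover have "boundary V (\<lambda>\<sigma>. y \<sigma> + w \<sigma>) = z"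
      unfolding boundary_add w(2) by (auto simp: ac_simps bit_add_self bit_add_self_right)
    ultimately show ?thesis by blast
  qed
qed

lemma shelling_acyclic_at:
  assumes "shelling K Fs" and "finite V" and "\<And>F. F \<in> facets K \<Longrightarrow> F \<subseteq> V \<and> c < card F"
  shows "acyclic_at V (generated_complex (facets K)) c"
proof -
  have "acyclic_at V (generated_complex (set (take j Fs))) c" if "j \<le> length Fs" for j
    using that
  proof (induction j)
    case 0
    show ?case
      unfolding acyclic_at_def
    proof (intro allI impI, elim conjE)
      fix z assume "chain (generated_complex (set (take 0 Fs))) c z" "boundary V z = (\<lambda>_. 0)"
      \<comment> \<open>The void complex carries only the zero chain, which fills itself.\<close>
      then show "\<exists>w. chain (generated_complex (set (take 0 Fs))) (c + 1) w \<and> boundary V w = z"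
        by (intro exI[of _ z]) (auto simp: chain_def generated_complex_def)
    qed
  next
    case (Suc j)
    have facet: "F \<subseteq> V \<and> c < card F" if "F \<in> set Fs" for F
      using that assms(1,3) by (auto simp: shelling_def)
    have "acyclic_at V (generated_complex (insert (Fs ! j) (set (take j Fs)))) c"
    proof (rule acyclic_at_add_facet[OF assms(2)])
      fix G assume G: "G \<in> facets (generated_complex (set (take j Fs)) \<inter> generated_complex {Fs ! j})"
      \<comment> \<open>Before the first facet the intersection is void and has no facets.\<close>
      then have "j \<noteq> 0" by (intro notI) (simp add: facets_def generated_complex_def)
      then show "card G + 1 = card (Fs ! j)"
        using assms(1) Suc.prems G unfolding shelling_def by auto
    next
      fix G assume "G \<in> insert (Fs ! j) (set (take j Fs))"
      then have "G \<in> set Fs" using Suc.prems by (auto dest: in_set_takeD)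
      then show "G \<subseteq> V" using facet by blast
    qed (use Suc facet in auto)
    then show ?case
      using Suc.prems by (simp add: take_Suc_conv_app_nth)
  qed
  from this[of "length Fs"] show ?thesis
    using assms(1) by (simp add: shelling_def)
qed

section \<open>Cut complexes of cycles\<close>

lemma independent_cycle_iff:
  "independent_set (cycle_vertices n) (cycle_edges n) S \<longleftrightarrow>
     S \<subseteq> {0..<n} \<and> (\<forall>i<n. i \<in> S \<longrightarrow> (i + 1) mod n \<notin> S)"
  unfolding independent_set_def cycle_vertices_def cycle_edges_def by auto

lemma independent_cycle_Suc:
  assumes "independent_set (cycle_vertices n) (cycle_edges n) S" "x \<in> S" "Suc x < n"
  shows "Suc x \<notin> S"
  using assms by (metis Suc_eq_plus1 Suc_lessD independent_cycle_iff mod_less)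

lemma independent_cycle_wrap:
  assumes "independent_set (cycle_vertices n) (cycle_edges n) S" "n - 1 \<in> S" "n > 0"
  shows "0 \<notin> S"
proof -
  have "(n - 1 + 1) mod n \<notin> S"
    using assms by (simp only: independent_cycle_iff) simp
  then show ?thesis using assms(3) by simp
qed

lemma independent_cycleI:
  assumes "S \<subseteq> {0..<n}" "\<And>x. x \<in> S \<Longrightarrow> Suc x < n \<Longrightarrow> Suc x \<notin> S" "n - 1 \<in> S \<Longrightarrow> 0 \<notin> S"
  shows "independent_set (cycle_vertices n) (cycle_edges n) S"
  unfolding independent_cycle_iff
proof (intro conjI allI impI)
  fix i assume i: "i < n" "i \<in> S"
  show "(i + 1) mod n \<notin> S"
  proof (cases "Suc i < n")
    case False
    then have "Suc i = n" using i by simp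
    then show ?thesis using i assms(3) by auto
  qed (use i assms(2) in auto)
qed (rule assms(1))

text \<open>\<open>S\<close> and its rotation by one step are disjoint and have the same
  size.\<close>

lemma independent_cycle_card:
  assumes S: "independent_set (cycle_vertices n) (cycle_edges n) S"
  shows "2 * card S \<le> n"
proof -
  let ?f = "\<lambda>i. (i + 1) mod n"
  have sub: "S \<subseteq> {0..<n}" using S by (simp add: independent_cycle_iff)
  then have fin: "finite S" using finite_subset by blast
  have inj: "inj_on ?f S"
  proof (rule inj_onI)
    fix x y assume "x \<in> S" "y \<in> S" "?f x = ?f y"
    moreover from this have "x < n" "y < n" using sub by auto
    ultimately show "x = y"
      by (cases "Suc x = n"; cases "Suc y = n") (auto simp: mod_if)
  qed
  have "S \<inter> ?f ` S = {}"
    using S sub by (auto simp: independent_cycle_iff)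
  then have "card S + card S = card (S \<union> ?f ` S)"
    using fin inj by (simp add: card_Un_disjoint card_image)
  also have "\<dots> \<le> card {0..<n}"
    using sub by (intro card_mono) auto
  finally show ?thesis by simp
qed

lemma independent_cycle_card_wrapped_arc:
  assumes S: "independent_set (cycle_vertices n) (cycle_edges n) S"
    and sub: "S \<subseteq> insert (n - 1) {0..<j}" and j: "Suc j \<le> 2 * l" "Suc j < n"
  shows "card S \<le> l"
proof -
  \<comment> \<open>The fibres of \<open>g\<close> on the arc \<open>n - 1, 0, \<dots>, j - 1\<close> are edges, and an edge meets \<open>S\<close> at most once.\<close>
  define g where "g x = (if x = n - 1 then 0 else Suc x div 2)" for x
  have "inj_on g S"
  proof (rule inj_onI)
    fix x y assume xy: "x \<in> S" "y \<in> S" "g x = g y"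
    then have "x = n - 1 \<or> x < j" "y = n - 1 \<or> y < j" using sub by auto
    then have "x = y \<or> y = Suc x \<or> x = Suc y \<or> x = n - 1 \<and> y = 0 \<or> y = n - 1 \<and> x = 0"
      using xy(3) unfolding g_def by (auto split: if_splits)
    then show "x = y"
      using xy independent_cycle_Suc[OF S] independent_cycle_wrap[OF S] j sub
      by (metis S atLeastLessThan_iff gr_zeroI independent_cycle_iff not_less_zero subsetD)
  qed
  moreover have "g ` S \<subseteq> {0..<l}"
    using sub j by (fastforce simp: g_def)
  ultimately have "card S \<le> card {0..<l}"
    by (metis card_image card_mono finite_atLeastLessThan)
  then show ?thesis by simp
qed

text \<open>The arc splits into the edges \<open>{2 * i, 2 * i + 1}\<close>, each of which meets
  \<open>S\<close> at most once.\<close>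

lemma independent_cycle_card_arc:
  assumes S: "independent_set (cycle_vertices n) (cycle_edges n) S"
    and sub: "S \<subseteq> {0..<2 * l}"
  shows "card S \<le> l"
proof -
  have "inj_on (\<lambda>x. x div 2) S"
  proof (rule inj_onI)
    fix x y assume xy: "x \<in> S" "y \<in> S" "x div 2 = y div 2"
    then have "x = y \<or> y = Suc x \<or> x = Suc y" by presburger
    then show "x = y"
      using xy independent_cycle_Suc[OF S]
      by (metis S atLeastLessThan_iff independent_cycle_iff subsetD)
  qed
  moreover have "(\<lambda>x. x div 2) ` S \<subseteq> {0..<l}"
    using sub by fastforce
  ultimately have "card S \<le> card {0..<l}"
    by (metis card_image card_mono finite_atLeastLessThan)
  then show ?thesis by simp
qed

section \<open>Deleting the initial vertices by collapses\<close>

abbreviation (input) cycle_cut_complex :: "nat \<Rightarrow> nat \<Rightarrow> nat set set" where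
  "cycle_cut_complex k n \<equiv> total_cut_complex k (cycle_vertices n) (cycle_edges n)"

lemma cycle_cut_complex_iff:
  "\<sigma> \<in> cycle_cut_complex k n \<longleftrightarrow> (\<sigma> \<subseteq> {0..<n} \<and>
     (\<exists>S. independent_set (cycle_vertices n) (cycle_edges n) S \<and> card S = k \<and> S \<inter> \<sigma> = {}))"
  unfolding total_cut_complex_def generated_complex_def cycle_vertices_def by blast

text \<open>Moving an element of \<open>S\<close> from \<open>i + 1\<close> back to \<open>i\<close>
  keeps \<open>S\<close> independent: the neighbour \<open>i - 1\<close> lies in the face, hence
  outside \<open>S\<close>, and the neighbour \<open>i + 1\<close> has just been given up.\<close>

lemma cycle_cut_complex_insert:
  assumes \<sigma>: "\<sigma> \<in> cycle_cut_complex k n" and i: "0 < i" "Suc i < n" "i - 1 \<in> \<sigma>" "i \<notin> \<sigma>"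
  shows "insert (Suc i) \<sigma> \<in> cycle_cut_complex k n"
proof -
  obtain S where S: "independent_set (cycle_vertices n) (cycle_edges n) S" "card S = k" "S \<inter> \<sigma> = {}"
    using \<sigma> by (auto simp: cycle_cut_complex_iff)
  have SV: "S \<subseteq> {0..<n}" using S by (simp add: independent_cycle_iff)
  then have fin: "finite S" using finite_subset by blast
  show ?thesis
  proof (cases "Suc i \<in> S")
    case False
    then show ?thesis using S \<sigma> i by (auto simp: cycle_cut_complex_iff)
  next
    case True
    define S' where "S' = insert i (S - {Suc i})"
    have iS: "i \<notin> S" using independent_cycle_Suc[OF S(1), of i] True i by auto
    have "independent_set (cycle_vertices n) (cycle_edges n) S'"
    proof (rule independent_cycleI)
      show "S' \<subseteq> {0..<n}" using SV i by (auto simp: S'_def)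
      show "Suc x \<notin> S'" if x: "x \<in> S'" "Suc x < n" for x
      proof
        assume "Suc x \<in> S'"
        then consider "Suc x = i" | "x = i" | "x \<in> S" "Suc x \<in> S"
          using x by (auto simp: S'_def)
        then show False
        proof cases
          case 1
          then have "x \<in> \<sigma>" "x \<noteq> i" using i by auto
          then show False using x S(3) by (auto simp: S'_def)
        next
          case 2
          then show False using \<open>Suc x \<in> S'\<close> by (auto simp: S'_def)
        qed (use independent_cycle_Suc[OF S(1)] x in blast)
      qed
      \<comment> \<open>The bounds on \<open>i\<close> keep it off both ends of the edge that closes
        the cycle.\<close>
      show "0 \<notin> S'" if "n - 1 \<in> S'"
        using that independent_cycle_wrap[OF S(1)] i by (auto simp: S'_def)
    qed
    moreover have "card S' = k"
      using True iS fin S(2) by (simp add: S'_def card_Suc_Diff1 del: card_Diff_insert)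
    moreover have "S' \<inter> insert (Suc i) \<sigma> = {}" using S(3) i by (auto simp: S'_def)
    moreover have "insert (Suc i) \<sigma> \<subseteq> {0..<n}" using \<sigma> i by (auto simp: cycle_cut_complex_iff)
    ultimately show ?thesis unfolding cycle_cut_complex_iff by blast
  qed
qed

definition initial_deletion :: "nat \<Rightarrow> nat \<Rightarrow> nat \<Rightarrow> nat set set" where
  "initial_deletion k n j = {\<sigma> \<in> cycle_cut_complex k n. \<sigma> \<inter> {0..<j} = {}}"

text \<open>As \<open>i\<close> decreases from \<open>n - 1\<close> to \<open>j + 1\<close>, this interpolates between the deletions of \<open>j\<close> and of
  \<open>j + 1\<close> vertices.\<close>

definition partial_deletion :: "nat \<Rightarrow> nat \<Rightarrow> nat \<Rightarrow> nat \<Rightarrow> nat set set" where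
  "partial_deletion k n j i = {\<sigma> \<in> initial_deletion k n j. \<not> {j..<i} \<subseteq> \<sigma>}"

lemma partial_deletion_collapse:
  assumes "j < i" "Suc i < n"
  shows "cone_collapse (partial_deletion k n j (Suc i)) (partial_deletion k n j i)"
  unfolding cone_collapse_def
proof (intro exI[of _ "{j..<i}"] exI[of _ "Suc i"] conjI ballI impI)
  fix \<sigma> assume \<sigma>: "\<sigma> \<in> partial_deletion k n j (Suc i)" and sub: "{j..<i} \<subseteq> \<sigma>"
  then have "i \<notin> \<sigma>"
    by (auto simp: partial_deletion_def atLeastLessThanSuc split: if_splits)
  moreover have "i - 1 \<in> \<sigma>" using sub assms by auto
  ultimately have "insert (Suc i) \<sigma> \<in> cycle_cut_complex k n"
    using \<sigma> assms by (intro cycle_cut_complex_insert)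
      (auto simp: partial_deletion_def initial_deletion_def)
  \<comment> \<open>The enlarged face still misses \<open>i\<close>, so it does not contain
    \<open>{j..<Suc i}\<close>.\<close>
  then show "insert (Suc i) \<sigma> \<in> partial_deletion k n j (Suc i)"
    using \<sigma> \<open>i \<notin> \<sigma>\<close> assms
    by (auto simp: partial_deletion_def initial_deletion_def subset_iff)
next
  show "partial_deletion k n j i = {\<sigma> \<in> partial_deletion k n j (Suc i). \<not> {j..<i} \<subseteq> \<sigma>}"
    using assms by (auto simp: partial_deletion_def subset_iff)
qed (use assms in auto)

text \<open>The interpolation has the right ends. For \<open>i = n - 1\<close> nothing is removed,
  since a face containing \<open>{j..<n - 1}\<close> would leave too short an arc for
  \<open>k\<close> independent vertices; for \<open>i = j + 1\<close> exactly the faces through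
  \<open>j\<close> are removed.\<close>

lemma initial_deletion_collapse_Suc:
  assumes "Suc (Suc j) < 2 * k" "2 * k \<le> n"
  shows "cone_collapse\<^sup>*\<^sup>* (initial_deletion k n j) (initial_deletion k n (Suc j))"
proof -
  have "cone_collapse\<^sup>*\<^sup>* (partial_deletion k n j (n - 1)) (partial_deletion k n j i)"
    if "i \<le> n - 1" "j < i" for i
    using that
  proof (induction i rule: inc_induct)
    case (step i)
    then show ?case
      using partial_deletion_collapse[of j i n k] by (simp add: rtranclp.rtrancl_into_rtrancl)
  qed simp
  from this[of "Suc j"]
  have "cone_collapse\<^sup>*\<^sup>* (partial_deletion k n j (n - 1)) (partial_deletion k n j (Suc j))"
    using assms by simp
  moreover have "partial_deletion k n j (n - 1) = initial_deletion k n j"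
  proof -
    have "\<not> {j..<n - 1} \<subseteq> \<sigma>" if \<sigma>: "\<sigma> \<in> initial_deletion k n j" for \<sigma>
    proof
      assume sub: "{j..<n - 1} \<subseteq> \<sigma>"
      obtain S where S: "independent_set (cycle_vertices n) (cycle_edges n) S" "card S = k" "S \<inter> \<sigma> = {}"
        using \<sigma> by (auto simp: initial_deletion_def cycle_cut_complex_iff)
      have SV: "S \<subseteq> {0..<n}" using S by (simp add: independent_cycle_iff)
      have "S \<subseteq> insert (n - 1) {0..<j}"
      proof
        fix x assume "x \<in> S"
        then have "x < n" "x \<notin> {j..<n - 1}" using SV S(3) sub by auto
        then show "x \<in> insert (n - 1) {0..<j}" by auto
      qed
      \<comment> \<open>The arc \<open>n - 1, 0, \<dots>, j - 1\<close> has \<open>j + 1\<close>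
        vertices, at most \<open>2 * (k - 1)\<close> of them.\<close>
      then have "card S \<le> k - 1"
        using independent_cycle_card_wrapped_arc[OF S(1), of j "k - 1"] assms by simp
      then show False using S(2) assms by simp
    qed
    then show ?thesis by (auto simp: partial_deletion_def)
  qed
  moreover have "partial_deletion k n j (Suc j) = initial_deletion k n (Suc j)"
    by (auto simp: partial_deletion_def initial_deletion_def atLeast0_lessThan_Suc)
  ultimately show ?thesis by simp
qed

lemma initial_deletion_simplex_boundary:
  assumes "2 \<le> k" "2 * k \<le> n"
  shows "initial_deletion k n (2 * k - 2) = {\<sigma>. \<sigma> \<subset> {2 * k - 2..<n}}"
proof (intro equalityI subsetI CollectI)
  fix \<sigma> assume \<sigma>: "\<sigma> \<in> initial_deletion k n (2 * k - 2)"
  then obtain S where S: "independent_set (cycle_vertices n) (cycle_edges n) S" "card S = k" "S \<inter> \<sigma> = {}"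
    by (auto simp: initial_deletion_def cycle_cut_complex_iff)
  have SV: "S \<subseteq> {0..<n}" using S by (simp add: independent_cycle_iff)
  have sub: "\<sigma> \<subseteq> {2 * k - 2..<n}"
  proof
    fix x assume "x \<in> \<sigma>"
    then have "x \<in> {0..<n}" "x \<notin> {0..<2 * k - 2}"
      using \<sigma> unfolding initial_deletion_def cycle_cut_complex_iff by blast+
    then show "x \<in> {2 * k - 2..<n}" by auto
  qed
  moreover have "\<sigma> \<noteq> {2 * k - 2..<n}"
  proof
    assume "\<sigma> = {2 * k - 2..<n}"
    then have "S \<subseteq> {0..<2 * (k - 1)}" using S(3) SV by fastforce
    then have "card S \<le> k - 1" by (rule independent_cycle_card_arc[OF S(1)])
    then show False using S(2) assms by simp
  qed
  ultimately show "\<sigma> \<subset> {2 * k - 2..<n}" by blast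
next
  fix \<sigma> assume "\<sigma> \<in> {\<sigma>. \<sigma> \<subset> {2 * k - 2..<n}}"
  then have sub: "\<sigma> \<subseteq> {2 * k - 2..<n}" and "\<exists>x. 2 * k - 2 \<le> x \<and> x < n \<and> x \<notin> \<sigma>" by auto
  then obtain x where x: "2 * k - 2 \<le> x" "x < n" "x \<notin> \<sigma>" by blast
  \<comment> \<open>The odd numbers up to \<open>2 * k - 3\<close> together with \<open>x\<close>.
    If \<open>x = 2 * k - 2\<close>, it is adjacent to the last of them, and the even numbers up to
    \<open>x\<close> serve instead.\<close>
  define S where "S = (if x = 2 * k - 2 then (\<lambda>i. 2 * i) ` {0..<k} else insert x ((\<lambda>i. 2 * i + 1) ` {0..<k - 1}))"
  have "card S = k"
  proof (cases "x = 2 * k - 2")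
    case True
    then show ?thesis by (simp add: S_def card_image inj_on_def)
  next
    case False
    have "x \<notin> (\<lambda>i. 2 * i + 1) ` {0..<k - 1}" using x by auto
    then show ?thesis using False assms by (simp add: S_def card_image inj_on_def)
  qed
  moreover have "independent_set (cycle_vertices n) (cycle_edges n) S"
  proof (rule independent_cycleI)
    show "S \<subseteq> {0..<n}" using x assms by (auto simp: S_def)
    show "Suc y \<notin> S" if "y \<in> S" for y
    proof (cases "x = 2 * k - 2")
      case True
      then show ?thesis using that by (auto simp: S_def) presburger
    next
      case False
      have "Suc y \<noteq> x" if "y \<in> (\<lambda>i. 2 * i + 1) ` {0..<k - 1}" using that x False by auto
      moreover have "Suc x \<notin> (\<lambda>i. 2 * i + 1) ` {0..<k - 1}" using x by auto
      moreover have "Suc y \<notin> (\<lambda>i. 2 * i + 1) ` {0..<k - 1}" if "y \<in> (\<lambda>i. 2 * i + 1) ` {0..<k - 1}"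
        using that by auto presburger
      ultimately show ?thesis using that False by (auto simp: S_def)
    qed
    \<comment> \<open>The odd choice omits 0. The even choice contains 0 but ends at
      \<open>2 * k - 2\<close>, which is less than \<open>n - 1\<close>.\<close>
    show "0 \<notin> S" if "n - 1 \<in> S"
      using that x assms by (auto simp: S_def split: if_splits)
  qed
  moreover have "S \<inter> \<sigma> = {}"
  proof -
    have "y = x \<or> y < 2 * k - 2" if "y \<in> S" for y
      using that by (auto simp: S_def split: if_splits)
    then show ?thesis using sub x by fastforce
  qed
  moreover have "\<sigma> \<subseteq> {0..<n}" "\<sigma> \<inter> {0..<2 * k - 2} = {}" using sub by fastforce+
  ultimately show "\<sigma> \<in> initial_deletion k n (2 * k - 2)"
    unfolding initial_deletion_def cycle_cut_complex_iff by blast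
qed

section \<open>The full sequence of collapses and its consequences\<close>

lemma cycle_cut_complex_collapse:
  assumes "2 \<le> k" "2 * k \<le> n"
  shows "cone_collapse\<^sup>*\<^sup>* (cycle_cut_complex k n) {\<sigma>. \<sigma> \<subset> {2 * k - 2..<n}}"
proof -
  have "cone_collapse\<^sup>*\<^sup>* (initial_deletion k n 0) (initial_deletion k n j)" if "j \<le> 2 * k - 2" for j
    using that
  proof (induction j)
    case (Suc j)
    then have "Suc j \<le> 2 * k - 2" "cone_collapse\<^sup>*\<^sup>* (initial_deletion k n 0) (initial_deletion k n j)"
      by auto
    moreover from this have "Suc (Suc j) < 2 * k" using assms by linarith
    ultimately show ?case
      using initial_deletion_collapse_Suc[of j k n] assms(2) rtranclp_trans by metis
  qed simp
  from this[of "2 * k - 2"] show ?thesis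
    unfolding initial_deletion_simplex_boundary[OF assms] by (simp add: initial_deletion_def)
qed

lemma cone_collapse_rtranclp:
  assumes "cone_collapse\<^sup>*\<^sup>* K K'" and "finite V" "K \<subseteq> Pow V" "abstract_simplicial_complex K"
  shows "geometric_realization K homotopy_equivalent_space geometric_realization K' \<and>
    (acyclic_at V K c \<longrightarrow> acyclic_at V K' c)"
proof -
  \<comment> \<open>The induction also carries what a single collapse requires of its
    source.\<close>
  have "K' \<subseteq> Pow V \<and> abstract_simplicial_complex K' \<and>
    geometric_realization K homotopy_equivalent_space geometric_realization K' \<and>
    (acyclic_at V K c \<longrightarrow> acyclic_at V K' c)"
    using assms(1)
  proof induction
    case base
    then show ?case using assms by (simp add: homotopy_equivalent_space_refl)
  next
    case (step K' K'')
    then have K': "K' \<subseteq> Pow V" "abstract_simplicial_complex K'" by auto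
    have "geometric_realization K homotopy_equivalent_space geometric_realization K''"
      using step.IH geometric_realization_cone_collapse[OF assms(2) K' step.hyps(2)]
      by (metis homotopy_eqv_trans)
    moreover have "acyclic_at V K c \<longrightarrow> acyclic_at V K'' c"
      using step.IH acyclic_at_cone_collapse[OF assms(2) K' step.hyps(2)] by simp
    ultimately show ?case
      using K' cone_collapse_subset[OF step.hyps(2)] cone_collapse_complex[OF step.hyps(2)] by simp
  qed
  then show ?thesis by blast
qed

theorem theorem4p15:
  fixes n k :: nat
  assumes "n \<ge> 3" and "k \<ge> 2"
  shows "(n < 2 * k \<longrightarrow>
            total_cut_complex k (cycle_vertices n) (cycle_edges n) = {} \<and>
            shellable (total_cut_complex k (cycle_vertices n) (cycle_edges n))) \<and>
         (n \<ge> 2 * k \<longrightarrow>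
            geometric_realization (total_cut_complex k (cycle_vertices n) (cycle_edges n))
              homotopy_equivalent_space nsphere (n - 2 * k) \<and>
            \<not> shellable (total_cut_complex k (cycle_vertices n) (cycle_edges n)))"
proof (intro conjI impI)
  assume "n < 2 * k"
  then show void: "cycle_cut_complex k n = {}"
    using independent_cycle_card by (force simp: cycle_cut_complex_iff)
  show "shellable (cycle_cut_complex k n)"
    unfolding void by (rule shellable_void)
next
  assume nk: "2 * k \<le> n"
  let ?K = "cycle_cut_complex k n" and ?\<tau> = "{2 * k - 2..<n}"
  have "?K \<subseteq> Pow {0..<n}"
    unfolding subset_iff cycle_cut_complex_iff by blast
  then have K: "finite {0..<n}" "?K \<subseteq> Pow {0..<n}" "abstract_simplicial_complex ?K"
    by (simp_all add: abstract_simplicial_complex_total_cut_complex cycle_vertices_def)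
  note col = cone_collapse_rtranclp[OF cycle_cut_complex_collapse[OF assms(2) nk] K]
  \<comment> \<open>There are \<open>n - 2 * k + 2\<close> vertices left, so the sphere has
    dimension \<open>n - 2 * k\<close>.\<close>
  have "?\<tau> = {2 * k - 2..2 * k - 2 + Suc (n - 2 * k)}"
    using assms nk by auto
  then have "geometric_realization {\<sigma>. \<sigma> \<subset> ?\<tau>} homotopy_equivalent_space nsphere (n - 2 * k)"
    using geometric_realization_simplex_boundary[of "2 * k - 2" "n - 2 * k"]
    by (simp add: homeomorphic_imp_homotopy_equivalent_space)
  then show "geometric_realization ?K homotopy_equivalent_space nsphere (n - 2 * k)"
    using col homotopy_eqv_trans by blast
  show "\<not> shellable ?K"
  proof
    assume "shellable ?K"
    then obtain Fs where Fs: "shelling ?K Fs" by (auto simp: shellable_def)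
    have facets: "facets ?K = {cycle_vertices n - S | S.
        independent_set (cycle_vertices n) (cycle_edges n) S \<and> card S = k}"
      by (rule facets_total_cut_complex) (simp add: cycle_vertices_def)
    \<comment> \<open>Facets have \<open>n - k\<close> vertices, and
      \<open>n - 2 * k + 1 < n - k\<close> amounts to \<open>k \<ge> 2\<close>. The degree
      \<open>n - 2 * k + 1\<close> is a cardinality and corresponds to dimension
      \<open>n - 2 * k\<close>.\<close>
    have "F \<subseteq> {0..<n} \<and> n - 2 * k + 1 < card F" if F: "F \<in> facets ?K" for F
    proof -
      obtain S where S: "F = {0..<n} - S" "S \<subseteq> {0..<n}" "card S = k"
        using F unfolding facets by (auto simp: cycle_vertices_def independent_set_def)
      then have "card F = n - k"
        by (metis K(1) card_Diff_subset card_atLeastLessThan diff_zero finite_subset)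
      then show ?thesis using S assms nk by auto
    qed
    then have "acyclic_at {0..<n} (generated_complex (facets ?K)) (n - 2 * k + 1)"
      by (rule shelling_acyclic_at[OF Fs K(1)])
    moreover have "generated_complex (facets ?K) = ?K"
      unfolding facets by (simp add: total_cut_complex_def)
    ultimately have "acyclic_at {0..<n} {\<sigma>. \<sigma> \<subset> ?\<tau>} (n - 2 * k + 1)"
      using col by simp
    moreover have "card ?\<tau> = Suc (n - 2 * k + 1)"
      using assms nk by auto
    ultimately show False
      using not_acyclic_at_simplex_boundary[OF K(1), of ?\<tau>] by auto
  qed
qed

end
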